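(* Let $a, b \in \mathbb{N}$ with $\gcd(a,b) = 1$. Then each divisor $m \in \mathbb{N}$ of $a^2 + ab + b^2$ is of the same form, i.e. there exist $c, d \in \mathbb{N}$ with $m = c^2 + cd + d^2$.
   Context: $\mathbb{N}$ denotes the set of positive integers, and $\gcd(a,b)$ denotes the greatest common divisor of $a$ and $b$.
   Formalization: For the divisor m = 1 the claim with positive c, d is false, since c^2+cd+d^2 ≥ 3 (e.g. a = b = 1, m = 1); there c, d are only required to be nonnegative integers, while for every other divisor m they are positive as claimed. *)

theory Defs
  imports Complex_Main
begin

text \<open>
  With \<open>c\<close> and \<open>d\<close> both positive, the form \<open>c\<^sup>2 + c d + d\<^sup>2\<close> never takes the value 1, although 1
  divides every number. Hence positivity of \<open>c\<close> and \<open>d\<close> can be claimed only for divisors other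
  than 1, and the divisor 1 needs the representation with \<open>c = 1\<close> and \<open>d = 0\<close>.
\<close>

lemma one_not_represented_by_positives:
  "\<not> (\<exists>c d :: nat. c > 0 \<and> d > 0 \<and> 1 = c\<^sup>2 + c * d + d\<^sup>2)"
proof (intro notI, elim exE conjE)
  fix c d :: nat
  assume pos: "c > 0" "d > 0" and eq: "1 = c\<^sup>2 + c * d + d\<^sup>2"
  have "c\<^sup>2 > 0" "d\<^sup>2 > 0"
    using pos by simp_all
  with eq show False
    by linarith
qed

end

theory Submission imports Defs "HOL-Number_Theory.Cong" begin

text \<open>
  Put \<open>t = b / a\<close> modulo \<open>m\<close>, so that \<open>t\<^sup>2 + t + 1 = m k\<close> for some \<open>k\<close>. The binary form
  \<open>m x\<^sup>2 + (2 t + 1) x y + k y\<^sup>2\<close> has discriminant \<open>-3\<close>. Gauss reduction brings it to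
  \<open>x\<^sup>2 + x y + y\<^sup>2\<close>, the only reduced positive form of this discriminant, so \<open>m\<close> is represented by
  \<open>x\<^sup>2 + x y + y\<^sup>2\<close> at coprime integers; the automorphisms of the form make both nonnegative.
  Coprimality is what excludes a zero argument when \<open>m \<noteq> 1\<close>.
\<close>

text \<open>
  The conclusion says that the matrix with rows \<open>(p, q)\<close> and \<open>(r, s)\<close> transforms
  \<open>x\<^sup>2 + x y + y\<^sup>2\<close> into \<open>m x\<^sup>2 + (2 t + 1) x y + k y\<^sup>2\<close>.
\<close>

lemma form_of_discriminant_minus_three_equivalent:
  fixes m t k :: int
  assumes "m > 0" and "m * k = t\<^sup>2 + t + 1"
  shows "\<exists>p q r s. p * s - q * r = 1 \<and> m = p\<^sup>2 + p * q + q\<^sup>2 \<and> k = r\<^sup>2 + r * s + s\<^sup>2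
    \<and> t = p * r + q * r + q * s"
  using assms
proof (induction "nat m" arbitrary: m t k rule: less_induct)
  case less
  show ?case
  proof (cases "m = 1")
    case True
    with less.prems show ?thesis
      by (intro exI[of _ 1] exI[of _ 0] exI[of _ t]) simp
  next
    case False
    with less.prems have "m \<ge> 2" by linarith
    \<comment> \<open>Rounds \<open>(2 * t + 1) / (2 * m)\<close> to a nearest integer, so that the
      substitution x \<rightarrow> x - n y leaves a middle coefficient \<open>2 * t' + 1\<close> in
      [-m, m); \<open>k'\<close> is the new last coefficient.\<close>
    define n where "n = (2 * t + 1 + m) div (2 * m)"
    define t' where "t' = t - n * m"
    define k' where "k' = k - n * (2 * t + 1) + n\<^sup>2 * m"
    have mk': "m * k' = t'\<^sup>2 + t' + 1"
      using less.prems(2) unfolding k'_def t'_def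
      by (simp add: algebra_simps power2_eq_square)
    have rem: "2 * t' + 1 + m = (2 * t + 1 + m) mod (2 * m)"
      unfolding t'_def n_def by (simp add: minus_mult_div_eq_mod [symmetric] algebra_simps)
    have "0 \<le> 2 * t' + 1 + m" "2 * t' + 1 + m < 2 * m"
      unfolding rem using \<open>m \<ge> 2\<close> by simp_all
    then have "\<bar>2 * t' + 1\<bar> \<le> \<bar>m\<bar>" by linarith
    then have "(2 * t' + 1)\<^sup>2 \<le> m\<^sup>2" by (rule abs_le_square_iff[THEN iffD1])
    then have "4 * (m * k') \<le> m\<^sup>2 + 3"
      unfolding mk' by (simp add: algebra_simps power2_eq_square)
    moreover have "m\<^sup>2 \<ge> 2 * 2"
      unfolding power2_eq_square using \<open>m \<ge> 2\<close> by (intro mult_mono) auto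
    ultimately have "m * k' < m * m" by (simp add: power2_eq_square)
    with \<open>m \<ge> 2\<close> have "k' < m" by simp
    have "4 * (m * k') = (2 * t' + 1)\<^sup>2 + 3"
      unfolding mk' by (simp add: algebra_simps power2_eq_square)
    then have "m * k' > 0" using zero_le_power2[of "2 * t' + 1"] by linarith
    with \<open>m \<ge> 2\<close> have "k' > 0" by (simp add: zero_less_mult_iff)
    \<comment> \<open>Rotating the variables swaps \<open>m\<close> with the smaller
      \<open>k'\<close> and negates the middle coefficient: -(2 t' + 1) = 2 (-t' - 1) + 1.\<close>
    have "k' * m = (- t' - 1)\<^sup>2 + (- t' - 1) + 1"
      using mk' by (simp add: algebra_simps power2_eq_square)
    with less.hyps[of k' m "- t' - 1"] \<open>k' < m\<close> \<open>k' > 0\<close>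
    obtain p q r s where det: "p * s - q * r = 1" and k': "k' = p\<^sup>2 + p * q + q\<^sup>2"
      and m: "m = r\<^sup>2 + r * s + s\<^sup>2" and t': "- t' - 1 = p * r + q * r + q * s"
      by auto
    have t: "t = t' + n * m" by (simp add: t'_def)
    have k: "k = k' + n * (2 * t' + 1) + n\<^sup>2 * m"
      unfolding k'_def t'_def by (simp add: algebra_simps power2_eq_square)
    have t'_eq: "t' = - (p * r) - p * s - q * s" using t' det by linarith
    have one: "2 * t' + 1 = - 2 * p * r - p * s - q * r - 2 * q * s"
      using t'_eq det by linarith
    show ?thesis
    \<comment> \<open>Undoing the rotation gives the rows \<open>(- r, - s)\<close> and
      \<open>(p, q)\<close>; undoing the shift adds \<open>n\<close> times the first row to the
      second.\<close>
    proof (intro exI conjI)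
      show "(- r) * (q - n * s) - (- s) * (p - n * r) = 1"
        using det by (simp add: algebra_simps)
      show "m = (- r)\<^sup>2 + (- r) * (- s) + (- s)\<^sup>2" using m by simp
      show "k = (p - n * r)\<^sup>2 + (p - n * r) * (q - n * s) + (q - n * s)\<^sup>2"
        unfolding k one k' m by (simp add: algebra_simps power2_eq_square)
      show "t = (- r) * (p - n * r) + (- s) * (p - n * r) + (- s) * (q - n * s)"
        unfolding t t'_eq m by (simp add: algebra_simps power2_eq_square)
    qed
  qed
qed

text \<open>The lines p = 0, q = 0 and p + q = 0 cut the plane into six sectors. An automorphism of
  the form carries each into the first quadrant; its determinant is 1 or -1, so coprimality
  survives.\<close>

lemma nonneg_coprime_representation:
  fixes p q :: int
  assumes "coprime p q"
  shows "\<exists>c d. c \<ge> 0 \<and> d \<ge> 0 \<and> coprime c d \<and> p\<^sup>2 + p * q + q\<^sup>2 = c\<^sup>2 + c * d + d\<^sup>2"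
proof -
  consider "p \<ge> 0" "q \<ge> 0" | "p \<le> 0" "q \<le> 0"
    | "q \<le> 0" "p + q \<ge> 0" | "p \<ge> 0" "p + q \<le> 0"
    | "p \<le> 0" "p + q \<ge> 0" | "q \<ge> 0" "p + q \<le> 0"
    by linarith
  then show ?thesis
  proof cases
    case 1
    with assms show ?thesis by blast
  next
    case 2
    with assms show ?thesis by (intro exI[of _ "- p"] exI[of _ "- q"]) simp
  next
    case 3
    with assms show ?thesis
      by (intro exI[of _ "p + q"] exI[of _ "- q"])
        (simp add: coprime_iff_gcd_eq_1 algebra_simps power2_eq_square)
  next
    case 4
    with assms show ?thesis
      by (intro exI[of _ p] exI[of _ "- (p + q)"])
        (simp add: coprime_iff_gcd_eq_1 algebra_simps power2_eq_square del: minus_add_distrib)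
  next
    case 5
    with assms show ?thesis
      by (intro exI[of _ "- p"] exI[of _ "p + q"])
        (simp add: coprime_iff_gcd_eq_1 algebra_simps power2_eq_square)
  next
    case 6
    with assms show ?thesis
      by (intro exI[of _ "- (p + q)"] exI[of _ q])
        (simp add: coprime_iff_gcd_eq_1 algebra_simps power2_eq_square del: minus_add_distrib)
  qed
qed

lemma ex_root_mod_divisor:
  fixes a b m :: int
  assumes "coprime a b" and "m dvd a\<^sup>2 + a * b + b\<^sup>2"
  shows "\<exists>t. m dvd t\<^sup>2 + t + 1"
proof -
  \<comment> \<open>Modulo \<open>a\<close> the value is \<open>b\<^sup>2\<close>, a unit; hence
    \<open>a\<close> is in turn invertible modulo \<open>m\<close>.\<close>
  have "coprime a ((a + b) * a + b\<^sup>2)"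
    using assms(1) by (metis coprime_iff_gcd_eq_1 coprime_power_right_iff gcd_add_mult)
  moreover have "(a + b) * a + b\<^sup>2 = a\<^sup>2 + a * b + b\<^sup>2"
    by (simp add: algebra_simps power2_eq_square)
  ultimately have "coprime a m"
    using assms(2) by (metis coprime_divisors dvd_refl)
  then obtain u where "[a * u = 1] (mod m)"
    using cong_solve_coprime_int by blast
  \<comment> \<open>Scaling the value by \<open>u\<^sup>2\<close> turns \<open>a\<close> into 1,
    which makes \<open>b * u\<close> the root.\<close>
  then have "[(a * u)\<^sup>2 + (a * u) * (b * u) + (b * u)\<^sup>2 = 1\<^sup>2 + 1 * (b * u) + (b * u)\<^sup>2] (mod m)"
    by (intro cong_add cong_mult cong_pow cong_refl)
  moreover have "(a * u)\<^sup>2 + (a * u) * (b * u) + (b * u)\<^sup>2 = u\<^sup>2 * (a\<^sup>2 + a * b + b\<^sup>2)"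
    by (simp add: algebra_simps power2_eq_square)
  ultimately have "m dvd 1\<^sup>2 + 1 * (b * u) + (b * u)\<^sup>2"
    using assms(2) by (metis cong_dvd_iff dvd_mult)
  then show ?thesis by (auto simp: ac_simps)
qed

theorem theorem5:
  fixes a b m :: nat
  assumes "a > 0" and "b > 0" and "gcd a b = 1"
    and "m > 0" and "m dvd a\<^sup>2 + a * b + b\<^sup>2"
  shows "\<exists>c d :: nat. m = c\<^sup>2 + c * d + d\<^sup>2 \<and> (m \<noteq> 1 \<longrightarrow> c > 0 \<and> d > 0)"
proof -
  have "coprime (int a) (int b)"
    using assms(3) by (simp add: coprime_iff_gcd_eq_1)
  moreover have "int m dvd (int a)\<^sup>2 + int a * int b + (int b)\<^sup>2"
    using assms(5) by (metis of_nat_add of_nat_dvd_iff of_nat_mult of_nat_power)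
  ultimately obtain t k where "int m * k = t\<^sup>2 + t + 1"
    using ex_root_mod_divisor by (metis dvdE)
  with assms(4) obtain p q r s where "p * s - q * r = 1" and m: "int m = p\<^sup>2 + p * q + q\<^sup>2"
    using form_of_discriminant_minus_three_equivalent[of "int m" k t] by auto
  \<comment> \<open>A common divisor of \<open>p\<close> and \<open>q\<close> divides the
    determinant 1.\<close>
  then have "coprime p q"
    by (metis coprimeI dvd_diff dvd_mult2)
  then obtain c d where "c \<ge> 0" "d \<ge> 0" "coprime c d" and cd: "int m = c\<^sup>2 + c * d + d\<^sup>2"
    using nonneg_coprime_representation m by metis
  then obtain c' d' where c'd': "c = int c'" "d = int d'"
    by (metis nonneg_int_cases)
  have "int m = int (c'\<^sup>2 + c' * d' + d'\<^sup>2)" using cd c'd' by simp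
  then have eq: "m = c'\<^sup>2 + c' * d' + d'\<^sup>2" by (rule of_nat_eq_iff[THEN iffD1])
  have "coprime c' d'" using \<open>coprime c d\<close> c'd' by simp
  \<comment> \<open>If one argument is 0, coprimality makes the other 1, and then m = 1.\<close>
  then have "m \<noteq> 1 \<longrightarrow> c' > 0 \<and> d' > 0" using eq by (auto intro!: Nat.gr0I)
  with eq show ?thesis by blast
qed

end
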